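(* Let Assumption A (see context) hold and let $\mu_n$, $\mu$ and $M_0$ be as defined in the context. Let $y\in M_0$ and let the discontinuities of $x\mapsto\rho(x,y)$ belong to a $\mu_X$-zero measurable set. Additionally, let $F$ be a separable Banach space with norm $\|\cdot\|$. If $\|\cdot\|\rho(\cdot,y)\in L^1(\mu_X)$ and $$\lim_{C\to\infty}\sup_n\int_{\{x:\|x\|^k\rho(x,y)>C\}}\|x\|^k\rho(x,y)\,d\mu_{X_n}(x)=0\quad\text{for }k=0,1,$$ then the conditional mean estimates $\int x\,\mu_n(dx,y)$ converge in the norm of $F$ to the conditional mean estimate $\int x\,\mu(dx,y)$ whenever the approximated prior distributions $\mu_{X_n}$ converge weakly to the prior distribution $\mu_X$.
   Context: A Souslin space is a Hausdorff topological space that is the image of a complete separable metric space under a continuous mapping. For a random variable $Z$, $\mu_Z=P\circ Z^{-1}$; for $x\in F$, $\mu_{\varepsilon+L(x)}$ is the image measure of $\omega\mapsto\varepsilon(\omega)+L(x)$. Borel measures and their Lebesgue completions are denoted by the same symbol. Assumption A: (1) $F$ and $G$ are locally convex Souslin topological vector spaces with Borel $\sigma$-algebras $\mathcal F$ and $\mathcal G$. (2) $(\Omega,\Sigma,P)$ is a complete probability space, $X$ and $X_n$ ($n\in\mathbf N$) are $F$-valued random variables on $\Omega$ and $\varepsilon$ is a $G$-valued random variable on $\Omega$; $X$ and $\varepsilon$ are independent, and $X_n$ and $\varepsilon$ are independent for each $n$. (3) $L:F\to G$ is continuous; $Y=L(X)+\varepsilon$ and $Y_n=L(X_n)+\varepsilon$.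 (4) $\mu_{\varepsilon+L(x)}$ is absolutely continuous with respect to some $\sigma$-finite measure $\nu$ on $(G,\mathcal G)$ for any $x\in F$, and its density $\rho(x,y):=\frac{d\mu_{\varepsilon+L(x)}}{d\nu}(y)$ is a $\mu_Z\times\nu$-measurable function on $F\times G$ for $Z=X$ and $Z=X_n$, $n\in\mathbf N$. Definitions: $M_0=\{y\in G:0<\int\rho(x,y)\,d\mu_Z(x)<\infty\text{ for }Z=X\text{ and }Z=X_n,\ n\in\mathbf N\}$, and for $U\in\mathcal F$, $y\in M_0$, $$\mu_n(U,y)=\frac{\int 1_U(x)\rho(x,y)\,d\mu_{X_n}(x)}{\int\rho(x,y)\,d\mu_{X_n}(x)},\qquad \mu(U,y)=\frac{\int 1_U(x)\rho(x,y)\,d\mu_X(x)}{\int\rho(x,y)\,d\mu_X(x)}.$$ The conditional mean integrals $\int x\,\mu_n(dx,y)$ and $\int x\,\mu(dx,y)$ are Bochner integrals in $F$. Measures $m_n$ on $F$ converge weakly to $m$ if $\int f\,dm_n\to\int f\,dm$ for all bounded continuous functions $f$ on $F$. *)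

theory Defs
  imports "HOL-Probability.Probability"
begin

section \<open>Locally convex Souslin spaces\<close>

text \<open>
  A continuous image of a complete separable metric space. HOL cannot quantify over the type of
  that metric space, so its points are taken to be real numbers; as a separable metric space has
  at most continuum many points this is no restriction, see \<open>souslin_spaceI\<close>. The Hausdorff axiom
  is the sort \<open>t2_space\<close>.
\<close>

definition souslin_space :: "'a::t2_space itself \<Rightarrow> bool" where
  "souslin_space _ \<longleftrightarrow>
     (\<exists>(Z :: real topology) (f :: real \<Rightarrow> 'a).
        completely_metrizable_space Z \<and> separable_space Z \<and>
        continuous_map Z euclidean f \<and> f ` topspace Z = UNIV)"

text \<open>The sort already contains continuity of addition and negation.\<close>

definition locally_convex_tvs :: "'a::{real_vector, topological_ab_group_add} itself \<Rightarrow> bool" where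
  "locally_convex_tvs _ \<longleftrightarrow>
     continuous_on UNIV (\<lambda>(r :: real, x :: 'a). r *\<^sub>R x) \<and>
     (\<forall>U :: 'a set. open U \<and> 0 \<in> U \<longrightarrow> (\<exists>V. open V \<and> convex V \<and> 0 \<in> V \<and> V \<subseteq> U))"

lemma (in Metric_space) separable_imp_lepoll_real:
  assumes "separable_space mtopology"
  shows "M \<lesssim> (UNIV :: real set)"
proof -
  obtain C where C: "countable C" "C \<subseteq> M" "mtopology closure_of C = M"
    using assms by (auto simp: separable_space_def)
  define g where "g x = {p \<in> C \<times> \<rat>. d x (fst p) < snd p}" for x
  have "inj_on g M"
  proof (rule inj_onI, rule ccontr)
    fix x y assume xy: "x \<in> M" "y \<in> M" "g x = g y" "x \<noteq> y"
    then have pos: "d x y / 2 > 0" by simp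
    have "x \<in> mtopology closure_of C" using C xy by simp
    then obtain c where c: "c \<in> C" "c \<in> mball x (d x y / 2)"
      using pos unfolding metric_closure_of by blast
    then have "d x c < d x y / 2" by simp
    then obtain q where q: "q \<in> \<rat>" "d x c < q" "q < d x y / 2"
      using Rats_dense_in_real by blast
    then have "(c, q) \<in> g x" using c by (simp add: g_def)
    then have "(c, q) \<in> g y" using xy(3) by metis
    then have "d y c < q" by (simp add: g_def)
    then show False using triangle[of x c y] q C c xy commute[of y c] by auto
  qed
  then have "M \<lesssim> Pow (C \<times> (\<rat> :: real set))"
    by (auto simp: lepoll_def g_def intro!: exI[of _ g])
  also have "\<dots> \<lesssim> (UNIV :: nat set set)"
  proof -
    have "countable (C \<times> (\<rat> :: real set))" using C countable_rat by auto
    then obtain h :: "_ \<Rightarrow> nat" where "inj_on h (C \<times> (\<rat> :: real set))" by (rule countableE)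
    then have "inj_on (image h) (Pow (C \<times> (\<rat> :: real set)))" by (rule inj_on_image_Pow)
    then show ?thesis by (auto simp: lepoll_def)
  qed
  also have "\<dots> \<lesssim> (UNIV :: real set)"
    using nat_sets_eqpoll_reals eqpoll_imp_lepoll by blast
  finally show ?thesis .
qed

lemma souslin_spaceI:
  fixes Z :: "'b topology" and f :: "'b \<Rightarrow> 'a::t2_space"
  assumes Z: "completely_metrizable_space Z" "separable_space Z"
    and f: "continuous_map Z euclidean f" "f ` topspace Z = UNIV"
  shows "souslin_space TYPE('a)"
proof -
  obtain M d where Md: "Metric_space M d" "Z = Metric_space.mtopology M d"
    using Z by (auto simp: completely_metrizable_space_def)
  then interpret Metric_space M d by simp
  obtain g :: "'b \<Rightarrow> real" where g: "inj_on g M"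
    using separable_imp_lepoll_real Z Md by (auto simp: lepoll_def)
  define h where "h = inv_into M g"
  define Z' where "Z' = pullback_topology (g ` M) h Z"
  have hg: "h (g x) = x" if "x \<in> M" for x using that g by (simp add: h_def)
  have topZ: "topspace Z = M" using Md by simp
  have topZ': "topspace Z' = g ` M"
    by (auto simp: Z'_def topspace_pullback_topology topZ hg)
  have "continuous_map Z' Z (id \<circ> h)"
    unfolding Z'_def by (rule continuous_map_pullback) simp
  then have contg': "continuous_map Z' Z h" by simp
  have "continuous_map Z Z (h \<circ> g)"
    by (rule continuous_map_eq[of _ _ id]) (simp_all add: topZ hg)
  then have contg: "continuous_map Z Z' g"
    unfolding Z'_def by (rule continuous_map_pullback') (use topZ in auto)
  have "homeomorphic_maps Z Z' g h"
    unfolding homeomorphic_maps_def using contg contg' by (auto simp: topZ topZ' hg)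
  then have hom: "Z homeomorphic_space Z'" by (auto simp: homeomorphic_space_def)
  have "completely_metrizable_space Z'"
    using Z hom homeomorphic_completely_metrizable_space by blast
  moreover have "separable_space Z'"
    using Z separable_space_continuous_map_image[OF _ contg] by (simp add: topZ topZ')
  moreover have "continuous_map Z' euclidean (f \<circ> h)"
    using contg' f(1) by (rule continuous_map_compose)
  moreover have "(f \<circ> h) ` topspace Z' = UNIV"
    using f by (simp add: topZ topZ' image_comp [symmetric] image_image hg)
  ultimately show ?thesis unfolding souslin_space_def by blast
qed

text \<open>Separable Banach spaces are instances.\<close>

lemma souslin_space_polish: "souslin_space TYPE('a::polish_space)"
proof (rule souslin_spaceI[of "euclidean :: 'a topology" id])
  obtain D :: "'a set" where "countable D" and D: "\<And>X. open X \<Longrightarrow> X \<noteq> {} \<Longrightarrow> \<exists>d\<in>D. d \<in> X"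
    using countable_dense_setE by metis
  then have "closure D = UNIV"
    using D[of "- closure D"] closure_subset[of D] by auto
  with \<open>countable D\<close> show "separable_space (euclidean :: 'a topology)"
    by (auto simp: separable_space_def)
qed (auto simp: completely_metrizable_space_euclidean)

lemma locally_convex_tvs_real_normed_vector:
  "locally_convex_tvs TYPE('a::real_normed_vector)"
  unfolding locally_convex_tvs_def
proof (intro conjI allI impI)
  show "continuous_on UNIV (\<lambda>(r :: real, x :: 'a). r *\<^sub>R x)"
    by (auto simp: case_prod_unfold intro!: continuous_intros)
next
  fix U :: "'a set" assume "open U \<and> 0 \<in> U"
  then obtain e where "e > 0" "ball 0 e \<subseteq> U" by (auto simp: open_contains_ball)
  then show "\<exists>V. open V \<and> convex V \<and> 0 \<in> V \<and> V \<subseteq> U"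
    by (intro exI[of _ "ball 0 e"]) auto
qed


section \<open>The observation model\<close>

text \<open>
  \<open>law P Z\<close> is \<open>P \<circ> Z\<^sup>-\<^sup>1\<close> on the Borel sets, completed: functions such as \<open>\<rho>(\<cdot>, y)\<close> are only
  required to be measurable with respect to Lebesgue completions.
\<close>

definition law :: "'w measure \<Rightarrow> ('w \<Rightarrow> 'a::topological_space) \<Rightarrow> 'a measure" where
  "law P Z = completion (distr P borel Z)"

text \<open>\<open>f\<close> is a (finite, nonnegative) version of \<open>dm / d\<nu>\<close>.\<close>

definition is_density :: "'a measure \<Rightarrow> 'a measure \<Rightarrow> ('a \<Rightarrow> real) \<Rightarrow> bool" where
  "is_density \<nu> m f \<longleftrightarrow>
     (\<forall>y. 0 \<le> f y) \<and> f \<in> borel_measurable (completion \<nu>) \<and>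
     (\<forall>B\<in>sets \<nu>. emeasure m B = (\<integral>\<^sup>+y. ennreal (f y) * indicator B y \<partial>completion \<nu>))"

text \<open>
  Independence of two random variables is written through their preimage sigma-algebras because
  \<open>indep_var\<close> requires both variables to take values in the same type. The map \<open>L\<close> need not be linear.
\<close>

locale observation_model = prob_space P + complete_measure P
  for P :: "'w measure" +
  fixes X :: "'w \<Rightarrow> 'f::{real_vector, topological_ab_group_add, t2_space}"
    and Xs :: "nat \<Rightarrow> 'w \<Rightarrow> 'f"
    and \<epsilon> :: "'w \<Rightarrow> 'g::{real_vector, topological_ab_group_add, t2_space}"
    and L :: "'f \<Rightarrow> 'g"
    and Y :: "'w \<Rightarrow> 'g"
    and Ys :: "nat \<Rightarrow> 'w \<Rightarrow> 'g"
    and \<nu> :: "'g measure"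
    and \<rho> :: "'f \<Rightarrow> 'g \<Rightarrow> real"
  assumes F_locally_convex: "locally_convex_tvs TYPE('f)"
    and F_souslin: "souslin_space TYPE('f)"
    and G_locally_convex: "locally_convex_tvs TYPE('g)"
    and G_souslin: "souslin_space TYPE('g)"
    and X_measurable: "random_variable borel X"
    and Xs_measurable: "\<And>n. random_variable borel (Xs n)"
    and eps_measurable: "random_variable borel \<epsilon>"
    and indep_X: "indep_set {X -` A \<inter> space P | A. A \<in> sets borel}
                            {\<epsilon> -` B \<inter> space P | B. B \<in> sets borel}"
    and indep_Xs: "\<And>n. indep_set {Xs n -` A \<inter> space P | A. A \<in> sets borel}
                                  {\<epsilon> -` B \<inter> space P | B. B \<in> sets borel}"
    and L_continuous: "continuous_on UNIV L"
    and Y_eq: "\<And>\<omega>. Y \<omega> = L (X \<omega>) + \<epsilon> \<omega>"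
    and Ys_eq: "\<And>n \<omega>. Ys n \<omega> = L (Xs n \<omega>) + \<epsilon> \<omega>"
    and nu_sigma_finite: "sigma_finite_measure \<nu>"
    and nu_sets: "sets \<nu> = sets borel"
    and nu_absolutely_continuous:
      "\<And>x. absolutely_continuous \<nu> (distr P borel (\<lambda>\<omega>. \<epsilon> \<omega> + L x))"
    and rho_density: "\<And>x. is_density \<nu> (distr P borel (\<lambda>\<omega>. \<epsilon> \<omega> + L x)) (\<rho> x)"
    and rho_measurable: "\<And>Z. Z \<in> insert X (range Xs) \<Longrightarrow>
      (\<lambda>(x, y). \<rho> x y) \<in> borel_measurable (completion (distr P borel Z \<Otimes>\<^sub>M \<nu>))"


section \<open>Posterior distributions\<close>

text \<open>
  Measurability of \<open>\<rho>(\<cdot>, y)\<close> is what makes the integral meaningful: joint measurability with respect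
  to the completed product only provides it for almost every \<open>y\<close>, and \<open>nn_integral\<close> is a lower
  integral on other functions.
\<close>

definition M0 :: "'w measure \<Rightarrow> ('w \<Rightarrow> 'f::topological_space) \<Rightarrow> (nat \<Rightarrow> 'w \<Rightarrow> 'f) \<Rightarrow>
    ('f \<Rightarrow> 'g \<Rightarrow> real) \<Rightarrow> 'g set" where
  "M0 P X Xs \<rho> = {y. \<forall>Z \<in> insert X (range Xs).
     (\<lambda>x. \<rho> x y) \<in> borel_measurable (law P Z) \<and>
     0 < (\<integral>\<^sup>+x. ennreal (\<rho> x y) \<partial>law P Z) \<and> (\<integral>\<^sup>+x. ennreal (\<rho> x y) \<partial>law P Z) < \<infinity>}"

definition posterior_prob :: "'f measure \<Rightarrow> ('f \<Rightarrow> 'g \<Rightarrow> real) \<Rightarrow> 'f set \<Rightarrow> 'g \<Rightarrow> real" where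
  "posterior_prob m \<rho> U y =
     (\<integral>x. indicator U x * \<rho> x y \<partial>m) / (\<integral>x. \<rho> x y \<partial>m)"

text \<open>The Borel measure \<open>U \<mapsto> posterior_prob m \<rho> U y\<close>.\<close>

definition posterior ::
  "'f::topological_space measure \<Rightarrow> ('f \<Rightarrow> 'g \<Rightarrow> real) \<Rightarrow> 'g \<Rightarrow> 'f measure" where
  "posterior m \<rho> y = measure_of UNIV (sets borel) (\<lambda>U. ennreal (posterior_prob m \<rho> U y))"

definition converges_weakly ::
  "(nat \<Rightarrow> 'a::topological_space measure) \<Rightarrow> 'a measure \<Rightarrow> bool" where
  "converges_weakly ms m \<longleftrightarrow>
     (\<forall>f :: 'a \<Rightarrow> real. continuous_on UNIV f \<and> bounded (range f) \<longrightarrow>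
        (\<lambda>n. \<integral>x. f x \<partial>ms n) \<longlonglongrightarrow> (\<integral>x. f x \<partial>m))"

end

(* The scalar mapping theorem needs only weak convergence: the inf-convolutions
   INF z. h z + k * dist x z are bounded and Lipschitz, lie below h, and increase to h at its
   continuity points, so they give one half of the convergence of the integrals, and -h gives
   the other. Truncation and uniform integrability extend this to unbounded h. For the
   Bochner integrals, a countable continuous partition of unity subordinate to small balls
   replaces the identity of F by a finite sum of weighted constant vectors, up to an error that is
   again controlled by scalar integrals. *)

theory Submission
  imports Defs
begin

section \<open>Lipschitz approximation of bounded functions from below\<close>

text \<open>The Pasch-Hausdorff envelope: for \<open>h\<close> bounded below it is the greatest
  \<open>k\<close>-Lipschitz function below \<open>h\<close>.\<close>

definition lipschitz_minorant :: "('a::metric_space \<Rightarrow> real) \<Rightarrow> nat \<Rightarrow> 'a \<Rightarrow> real" where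
  "lipschitz_minorant h k x = (INF z. h z + real k * dist x z)"

text \<open>The candidate \<open>z = x\<close> bounds the infimum by \<open>h x\<close>, and
  \<open>- B\<close> lies below every candidate. By the triangle inequality, passing from
  \<open>v\<close> to \<open>u\<close> changes a candidate by at most \<open>k * dist u v\<close>,
  whence the Lipschitz property. At a continuity point, values \<open>h z\<close> at nearby
  \<open>z\<close> are close to \<open>h x\<close>, and distant \<open>z\<close> are ruled out by
  the penalty once \<open>k\<close> is large.\<close>

lemma
  fixes h :: "'a::metric_space \<Rightarrow> real"
  assumes bound: "\<And>x. \<bar>h x\<bar> \<le> B"
  shows lipschitz_minorant_le: "lipschitz_minorant h k x \<le> h x"
    and abs_lipschitz_minorant_le: "\<bar>lipschitz_minorant h k x\<bar> \<le> B"
    and continuous_on_lipschitz_minorant: "continuous_on UNIV (lipschitz_minorant h k)"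
    and lipschitz_minorant_tendsto:
      "isCont h x \<Longrightarrow> (\<lambda>k. lipschitz_minorant h k x) \<longlonglongrightarrow> h x"
proof -
  have low: "- B \<le> h z + real j * dist w z" for j w z
    using bound[of z] by (smt (verit) mult_nonneg_nonneg of_nat_0_le_iff zero_le_dist)
  have le: "lipschitz_minorant h j w \<le> h z + real j * dist w z" for j w z
    unfolding lipschitz_minorant_def
    by (rule cINF_lower) (auto intro!: bdd_belowI2[of _ "- B"] low)
  have le_h: "lipschitz_minorant h j w \<le> h w" for j w
    using le[of j w w] by simp
  then show "lipschitz_minorant h k x \<le> h x" .
  have ge: "c \<le> lipschitz_minorant h j w" if "\<And>z. c \<le> h z + real j * dist w z" for c j w
    unfolding lipschitz_minorant_def by (rule cINF_greatest) (use that in auto)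
  show "\<bar>lipschitz_minorant h k x\<bar> \<le> B"
    using ge[of "- B" k x] low le_h[of k x] bound[of x] by (smt (verit))
  have half: "lipschitz_minorant h k u - real k * dist u v \<le> lipschitz_minorant h k v" for u v
  proof (rule ge)
    fix z
    have "real k * dist u z \<le> real k * dist u v + real k * dist v z"
      using mult_left_mono[OF dist_triangle[of u z v], of "real k"] by (simp add: algebra_simps)
    then show "lipschitz_minorant h k u - real k * dist u v \<le> h z + real k * dist v z"
      using le[of k u z] by linarith
  qed
  have "(real k)-lipschitz_on UNIV (lipschitz_minorant h k)"
  proof (rule lipschitz_onI)
    fix u v
    show "dist (lipschitz_minorant h k u) (lipschitz_minorant h k v) \<le> real k * dist u v"
      using half[of u v] half[of v u] by (simp add: dist_real_def dist_commute abs_le_iff)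
  qed simp
  then show "continuous_on UNIV (lipschitz_minorant h k)"
    by (rule lipschitz_on_continuous_on)
  show "(\<lambda>k. lipschitz_minorant h k x) \<longlonglongrightarrow> h x" if "isCont h x"
  proof (rule LIMSEQ_I)
    fix e :: real assume "0 < e"
    then obtain d where d: "d > 0" "\<And>z. dist z x < d \<Longrightarrow> dist (h z) (h x) < e / 2"
      using \<open>isCont h x\<close> unfolding continuous_at_eps_delta by (metis half_gt_zero)
    \<comment> \<open>\<open>2 * B\<close> bounds the oscillation of \<open>h\<close>; from
      \<open>k0\<close> on, the penalty at distance at least \<open>d\<close> is no smaller.\<close>
    obtain k0 :: nat where k0: "2 * B / d \<le> real k0"
      using real_arch_simple by blast
    have "norm (lipschitz_minorant h k x - h x) < e" if "k \<ge> k0" for k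
    proof -
      have "h x - e / 2 \<le> lipschitz_minorant h k x"
      proof (rule ge)
        fix z
        show "h x - e / 2 \<le> h z + real k * dist x z"
        proof (cases "dist z x < d")
          case True
          have "0 \<le> real k * dist x z" by simp
          then show ?thesis
            using d(2)[OF True] unfolding dist_real_def by linarith
        next
          case False
          have "2 * B \<le> real k0 * d"
            using k0 d(1) by (simp add: divide_le_eq)
          also have "\<dots> \<le> real k * dist x z"
            using False d(1) that by (intro mult_mono) (auto simp: dist_commute)
          finally show ?thesis
            using bound[of x] bound[of z] \<open>0 < e\<close> by linarith
        qed
      qed
      then show ?thesis using le_h[of k x] \<open>0 < e\<close> by simp
    qed
    then show "\<exists>k0. \<forall>k\<ge>k0. norm (lipschitz_minorant h k x - h x) < e" by blast
  qed
qed

section \<open>Weak convergence tested on bounded, almost everywhere continuous functions\<close>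

text \<open>
  The measures may live on a sigma-algebra larger than the Borel sets, such as a completion;
  measurability of the identity expresses the inclusion.
\<close>

locale weak_limit = M: prob_space M
  for M :: "'a::metric_space measure" +
  fixes Ms :: "nat \<Rightarrow> 'a measure"
  assumes prob_Ms: "\<And>n. prob_space (Ms n)"
    and borel_M: "(\<lambda>x. x) \<in> borel_measurable M"
    and borel_Ms: "\<And>n. (\<lambda>x. x) \<in> borel_measurable (Ms n)"
    and weak: "converges_weakly Ms M"
begin

lemma continuous_measurable:
  fixes f :: "'a \<Rightarrow> 'b::topological_space"
  assumes "continuous_on UNIV f"
  shows "f \<in> borel_measurable M" "f \<in> borel_measurable (Ms n)"
  using measurable_compose[OF borel_M borel_measurable_continuous_onI[OF assms]]
    measurable_compose[OF borel_Ms borel_measurable_continuous_onI[OF assms]] by auto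

text \<open>The index \<open>k\<close> is chosen from the limit measure alone, by dominated
  convergence. Weak convergence is then applied to this single minorant, so nothing has to be
  uniform in \<open>n\<close>.\<close>

lemma integral_lower_bound:
  fixes h :: "'a \<Rightarrow> real"
  assumes bound: "\<And>x. \<bar>h x\<bar> \<le> B"
    and [measurable]: "h \<in> borel_measurable M" "\<And>n. h \<in> borel_measurable (Ms n)"
    and cont: "AE x in M. isCont h x"
    and less: "c < (\<integral>x. h x \<partial>M)"
  shows "\<forall>\<^sub>F n in sequentially. c < (\<integral>x. h x \<partial>Ms n)"
proof -
  note lip = lipschitz_minorant_le[of h, OF bound] abs_lipschitz_minorant_le[of h, OF bound]
    continuous_on_lipschitz_minorant[of h, OF bound] lipschitz_minorant_tendsto[of h, OF bound]
  have "(\<lambda>k. \<integral>x. lipschitz_minorant h k x \<partial>M) \<longlonglongrightarrow> (\<integral>x. h x \<partial>M)"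
  proof (rule integral_dominated_convergence[where w = "\<lambda>_. B"])
    show "AE x in M. (\<lambda>k. lipschitz_minorant h k x) \<longlonglongrightarrow> h x"
      using cont by eventually_elim (rule lip(4))
  qed (use lip(2) in \<open>auto intro!: continuous_measurable lip(3)\<close>)
  from order_tendstoD(1)[OF this less]
  obtain k where k: "c < (\<integral>x. lipschitz_minorant h k x \<partial>M)"
    by (metis eventually_sequentially order_refl)
  have "(\<lambda>n. \<integral>x. lipschitz_minorant h k x \<partial>Ms n) \<longlonglongrightarrow> (\<integral>x. lipschitz_minorant h k x \<partial>M)"
    using weak lip(2)[of k] lip(3)[of k] unfolding converges_weakly_def
    by (auto simp: bounded_iff)
  from order_tendstoD(1)[OF this k] show ?thesis
  proof eventually_elim
    case (elim n)
    interpret N: prob_space "Ms n" by (rule prob_Ms)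
    have "(\<integral>x. lipschitz_minorant h k x \<partial>Ms n) \<le> (\<integral>x. h x \<partial>Ms n)"
      using lip(2)[of k] bound
      by (intro integral_mono N.integrable_const_bound[where B = B] lip(1))
        (auto intro!: continuous_measurable(2) lip(3))
    with elim show ?case by simp
  qed
qed

lemma integral_tendsto_bounded:
  fixes h :: "'a \<Rightarrow> real"
  assumes bound: "\<And>x. \<bar>h x\<bar> \<le> B"
    and meas: "h \<in> borel_measurable M" "\<And>n. h \<in> borel_measurable (Ms n)"
    and cont: "AE x in M. isCont h x"
  shows "(\<lambda>n. \<integral>x. h x \<partial>Ms n) \<longlonglongrightarrow> (\<integral>x. h x \<partial>M)"
proof (rule order_tendstoI)
  fix c assume "c < (\<integral>x. h x \<partial>M)"
  then show "\<forall>\<^sub>F n in sequentially. c < (\<integral>x. h x \<partial>Ms n)"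
    by (rule integral_lower_bound[OF assms])
next
  fix c assume "(\<integral>x. h x \<partial>M) < c"
  then have less: "- c < (\<integral>x. - h x \<partial>M)" by simp
  have "AE x in M. isCont (\<lambda>x. - h x) x"
    using cont by eventually_elim (rule continuous_minus)
  then have "\<forall>\<^sub>F n in sequentially. - c < (\<integral>x. - h x \<partial>Ms n)"
    using bound meas less by (intro integral_lower_bound[of "\<lambda>x. - h x" B]) auto
  then show "\<forall>\<^sub>F n in sequentially. (\<integral>x. h x \<partial>Ms n) < c" by simp
qed

end

section \<open>Uniform integrability and unbounded integrands\<close>

text \<open>Uniform integrability of a nonnegative \<open>g\<close> along \<open>Ms\<close>. With
  the nonnegative integral the supremum makes sense before integrability is known.\<close>

definition tails_vanish :: "(nat \<Rightarrow> 'a measure) \<Rightarrow> ('a \<Rightarrow> real) \<Rightarrow> bool" where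
  "tails_vanish Ms g \<longleftrightarrow>
     ((\<lambda>C. SUP n. \<integral>\<^sup>+x. ennreal (g x) * indicator {x. g x > C} x \<partial>Ms n) \<longlongrightarrow> 0) at_top"

lemma tails_vanishD:
  assumes "tails_vanish Ms g" "0 < e"
  shows "\<forall>\<^sub>F C in at_top. \<forall>n. (\<integral>\<^sup>+x. ennreal (g x) * indicator {x. g x > C} x \<partial>Ms n) < ennreal e"
proof -
  have "\<forall>\<^sub>F C in at_top.
      (SUP n. \<integral>\<^sup>+x. ennreal (g x) * indicator {x. g x > C} x \<partial>Ms n) < ennreal e"
    using assms unfolding tails_vanish_def by (intro order_tendstoD) auto
  then show ?thesis
  proof eventually_elim
    case (elim C)
    show ?case
    proof
      fix n
      have "(\<integral>\<^sup>+x. ennreal (g x) * indicator {x. g x > C} x \<partial>Ms n)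
          \<le> (SUP n. \<integral>\<^sup>+x. ennreal (g x) * indicator {x. g x > C} x \<partial>Ms n)"
        by (rule SUP_upper) simp
      then show "(\<integral>\<^sup>+x. ennreal (g x) * indicator {x. g x > C} x \<partial>Ms n) < ennreal e"
        using elim by (rule le_less_trans)
    qed
  qed
qed

text \<open>Over a probability measure the part of \<open>g\<close> up to a level \<open>C\<close>
  contributes at most \<open>C\<close>, and for a suitable \<open>C\<close> the tail above it has
  integral below 1.\<close>

lemma tails_vanish_integrable:
  assumes "tails_vanish Ms g" "prob_space (Ms n)"
    and [measurable]: "g \<in> borel_measurable (Ms n)" and nonneg: "\<And>x. 0 \<le> g x"
  shows "integrable (Ms n) g"
proof (rule integrableI_nonneg)
  interpret prob_space "Ms n" by fact
  have "\<exists>C. \<forall>n. (\<integral>\<^sup>+x. ennreal (g x) * indicator {x. g x > C} x \<partial>Ms n) < ennreal 1"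
    by (rule eventually_happens'[OF trivial_limit_at_top_linorder tails_vanishD[OF assms(1) zero_less_one]])
  then obtain C where C: "(\<integral>\<^sup>+x. ennreal (g x) * indicator {x. g x > C} x \<partial>Ms n) < ennreal 1"
    by blast
  have "(\<integral>\<^sup>+x. ennreal (g x) \<partial>Ms n)
      \<le> (\<integral>\<^sup>+x. ennreal C + ennreal (g x) * indicator {x. g x > C} x \<partial>Ms n)"
    by (intro nn_integral_mono) (auto split: split_indicator intro: ennreal_leI)
  also have "\<dots> = ennreal C + (\<integral>\<^sup>+x. ennreal (g x) * indicator {x. g x > C} x \<partial>Ms n)"
    by (subst nn_integral_add) (auto simp: emeasure_space_1)
  also have "\<dots> < \<infinity>"
    using C by (auto simp: less_top[symmetric])
  finally show "(\<integral>\<^sup>+x. ennreal (g x) \<partial>Ms n) < \<infinity>" .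
qed (use nonneg in auto)

text \<open>The truncation \<open>min (h x) C\<close> is bounded and continuous wherever
  \<open>h\<close> is, and the error it causes is controlled by the tail of \<open>g\<close>,
  uniformly in \<open>n\<close>. Keeping the dominating \<open>g\<close> apart from \<open>h\<close>
  lets one tail condition serve every product of \<open>g\<close> with a weight between 0 and
  1.\<close>

lemma (in weak_limit) integral_tendsto_tails_vanish:
  fixes g h :: "'a \<Rightarrow> real"
  assumes tails: "tails_vanish Ms g"
    and h: "\<And>x. 0 \<le> h x" "\<And>x. h x \<le> g x"
    and meas_h[measurable]: "\<And>n. h \<in> borel_measurable (Ms n)"
    and meas_g[measurable]: "\<And>n. g \<in> borel_measurable (Ms n)"
    and int_h: "integrable M h"
    and cont: "AE x in M. isCont h x"
  shows "(\<lambda>n. \<integral>x. h x \<partial>Ms n) \<longlonglongrightarrow> (\<integral>x. h x \<partial>M)"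
proof (rule LIMSEQ_I)
  fix e :: real assume e: "0 < e"
  have [measurable]: "h \<in> borel_measurable M" using int_h by simp
  have g: "0 \<le> g x" for x using h(1)[of x] h(2)[of x] by simp
  have int_g: "integrable (Ms n) g" for n
    using tails prob_Ms meas_g g by (rule tails_vanish_integrable)
  have int_hn: "integrable (Ms n) h" for n
    by (rule Bochner_Integration.integrable_bound[OF int_g]) (use h g in auto)
  have int_min: "integrable N (\<lambda>x. min (h x) C)" if "integrable N h" "C \<ge> 0" for N C
    by (rule Bochner_Integration.integrable_bound[OF that(1)]) (use h that in auto)
  have "((\<lambda>C. \<integral>x. min (h x) C \<partial>M) \<longlongrightarrow> (\<integral>x. h x \<partial>M)) at_top"
  proof (rule integral_dominated_convergence_at_top[where w = h])
    show "\<forall>\<^sub>F C in at_top. AE x in M. norm (min (h x) C) \<le> h x"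
      using eventually_ge_at_top[of 0] by eventually_elim (use h in auto)
    show "AE x in M. ((\<lambda>C. min (h x) C) \<longlongrightarrow> h x) at_top"
    proof (rule AE_I2)
      fix x
      show "((\<lambda>C. min (h x) C) \<longlongrightarrow> h x) at_top"
        by (rule tendsto_eventually)
          (use eventually_ge_at_top[of "h x"] in \<open>eventually_elim, simp\<close>)
    qed
  qed (use int_h in auto)
  \<comment> \<open>One level \<open>C\<close> handles the truncation error under \<open>M\<close>
    and under all \<open>Ms n\<close> at once; the remaining third of \<open>e\<close> is left for
    the convergence of the truncated integrals.\<close>
  from tendstoD[OF this, of "e / 3"] tails_vanishD[OF tails, of "e / 3"]
  have "\<forall>\<^sub>F C in at_top. dist (\<integral>x. min (h x) C \<partial>M) (\<integral>x. h x \<partial>M) < e / 3 \<and>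
      (\<forall>n. (\<integral>\<^sup>+x. ennreal (g x) * indicator {x. g x > C} x \<partial>Ms n) < ennreal (e / 3)) \<and> 0 \<le> C"
    using e eventually_ge_at_top[of "0::real"] by (intro eventually_conj) simp_all
  then obtain C where C: "dist (\<integral>x. min (h x) C \<partial>M) (\<integral>x. h x \<partial>M) < e / 3"
      "\<And>n. (\<integral>\<^sup>+x. ennreal (g x) * indicator {x. g x > C} x \<partial>Ms n) < ennreal (e / 3)" "0 \<le> C"
    using eventually_happens'[OF trivial_limit_at_top_linorder] by blast
  have tail: "\<bar>(\<integral>x. h x \<partial>Ms n) - (\<integral>x. min (h x) C \<partial>Ms n)\<bar> < e / 3" for n
  proof -
    have "ennreal (\<integral>x. h x - min (h x) C \<partial>Ms n) = (\<integral>\<^sup>+x. ennreal (h x - min (h x) C) \<partial>Ms n)"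
      by (intro nn_integral_eq_integral[symmetric]) (auto intro!: int_hn int_min C(3))
    \<comment> \<open>The left integrand vanishes where \<open>h x \<le> C\<close>. Elsewhere
      \<open>g x \<ge> h x > C\<close>, and \<open>0 \<le> C\<close> gives
      \<open>h x - C \<le> g x\<close>.\<close>
    also have "\<dots> \<le> (\<integral>\<^sup>+x. ennreal (g x) * indicator {x. g x > C} x \<partial>Ms n)"
    proof (rule nn_integral_mono)
      fix x
      show "ennreal (h x - min (h x) C) \<le> ennreal (g x) * indicator {x. g x > C} x"
        using h[of x] C(3) by (auto split: split_indicator intro!: ennreal_leI simp: min_def)
    qed
    also have "\<dots> < ennreal (e / 3)" by (rule C(2))
    finally have "(\<integral>x. h x - min (h x) C \<partial>Ms n) < e / 3"
      using e by (simp add: ennreal_less_iff)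
    moreover have "0 \<le> (\<integral>x. h x - min (h x) C \<partial>Ms n)"
      by (intro integral_nonneg_AE) auto
    ultimately show ?thesis
      by (simp add: int_hn int_min C(3))
  qed
  have "AE x in M. isCont (\<lambda>x. min (h x) C) x"
    using cont by eventually_elim (intro continuous_intros)
  then have "(\<lambda>n. \<integral>x. min (h x) C \<partial>Ms n) \<longlonglongrightarrow> (\<integral>x. min (h x) C \<partial>M)"
    using h C(3) by (intro integral_tendsto_bounded[of _ C]) (auto simp: abs_le_iff min_def)
  from LIMSEQ_D[OF this, of "e / 3"] e obtain n0 where
    n0: "\<And>n. n \<ge> n0 \<Longrightarrow> norm ((\<integral>x. min (h x) C \<partial>Ms n) - (\<integral>x. min (h x) C \<partial>M)) < e / 3"
    by auto
  have "norm ((\<integral>x. h x \<partial>Ms n) - (\<integral>x. h x \<partial>M)) < e" if "n \<ge> n0" for n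
    using n0[OF that] tail[of n] C(1) unfolding real_norm_def dist_real_def by linarith
  then show "\<exists>n0. \<forall>n\<ge>n0. norm ((\<integral>x. h x \<partial>Ms n) - (\<integral>x. h x \<partial>M)) < e" by blast
qed

section \<open>Discretizing vector-valued integrals by a partition of unity\<close>

text \<open>Stick-breaking along a dense sequence: \<open>\<psi> i\<close> takes the fraction
  \<open>u i\<close> of the mass \<open>r i\<close> that the earlier indices left over, so the
  partial sums telescope to \<open>1 - r I x\<close>.\<close>

lemma countable_partition_of_unity:
  fixes \<delta> :: real
  assumes "\<delta> > 0"
  obtains d :: "nat \<Rightarrow> 'a::{metric_space, second_countable_topology}" and \<psi> :: "nat \<Rightarrow> 'a \<Rightarrow> real"
  where "\<And>i. continuous_on UNIV (\<psi> i)" "\<And>i x. 0 \<le> \<psi> i x" "\<And>i x. \<psi> i x \<noteq> 0 \<Longrightarrow> dist x (d i) \<le> \<delta>"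
    "\<And>I x. (\<Sum>i<I. \<psi> i x) \<le> 1" "\<And>x. (\<lambda>i. \<psi> i x) sums 1"
proof -
  obtain D :: "'a set" where D: "countable D" "\<And>U. open U \<Longrightarrow> U \<noteq> {} \<Longrightarrow> \<exists>d\<in>D. d \<in> U"
    using countable_dense_setE by metis
  have "D \<noteq> {}" using D(2)[of UNIV] by auto
  \<comment> \<open>A finite \<open>D\<close> is enumerated with repetitions, which does no
    harm.\<close>
  define d where "d = from_nat_into D"
  \<comment> \<open>A continuous bump: 1 up to distance \<open>\<delta> / 2\<close> from
    \<open>d i\<close>, and 0 from distance \<open>\<delta>\<close> on.\<close>
  define u where "u i x = min 1 (max 0 (2 - 2 * dist x (d i) / \<delta>))" for i x
  define r where "r I x = (\<Prod>j<I. 1 - u j x)" for I x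
  define \<psi> where "\<psi> i x = u i x * r i x" for i x
  have u: "0 \<le> u i x" "u i x \<le> 1" for i x by (auto simp: u_def)
  have r: "0 \<le> r i x" for i x unfolding r_def using u by (intro prod_nonneg) auto
  have sum_eq: "(\<Sum>i<I. \<psi> i x) = 1 - r I x" for I x
    by (induction I) (auto simp: r_def \<psi>_def algebra_simps)
  show thesis
  proof
    show "continuous_on UNIV (\<psi> i)" for i
      unfolding \<psi>_def r_def u_def using assms by (intro continuous_intros) auto
    show "0 \<le> \<psi> i x" for i x using u r by (simp add: \<psi>_def)
    show "dist x (d i) \<le> \<delta>" if "\<psi> i x \<noteq> 0" for i x
    proof (rule ccontr)
      assume "\<not> dist x (d i) \<le> \<delta>"
      then have "2 - 2 * dist x (d i) / \<delta> \<le> 0" using assms by (simp add: field_simps)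
      then have "u i x = 0" by (simp add: u_def)
      with that show False by (simp add: \<psi>_def)
    qed
    show "(\<Sum>i<I. \<psi> i x) \<le> 1" for I x using r by (simp add: sum_eq)
    show "(\<lambda>i. \<psi> i x) sums 1" for x
    proof -
      \<comment> \<open>A center within \<open>\<delta> / 2\<close> makes the factor
        \<open>1 - u i x\<close> vanish, so the partial sums are exactly 1 from \<open>Suc i\<close>
        on.\<close>
      obtain p where "p \<in> D" "p \<in> ball x (\<delta> / 2)"
        using D(2)[of "ball x (\<delta> / 2)"] assms by auto
      moreover obtain i where "d i = p"
        using from_nat_into_surj[OF D(1) \<open>p \<in> D\<close>] by (auto simp: d_def)
      ultimately have "2 - 2 * dist x (d i) / \<delta> \<ge> 1" using assms by (simp add: field_simps)
      then have "u i x = 1" by (simp add: u_def)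
      then have "r I x = 0" if "I \<ge> Suc i" for I
        unfolding r_def using that by (auto intro!: prod_zero bexI[of _ i])
      then have "\<forall>\<^sub>F I in sequentially. (\<Sum>i<I. \<psi> i x) = 1"
        unfolding sum_eq eventually_sequentially by (intro exI[of _ "Suc i"]) simp
      then show ?thesis unfolding sums_def by (rule tendsto_eventually)
    qed
  qed
qed

text \<open>Split \<open>x\<close> into the share carried by the first \<open>I\<close> weights and
  the missing share. In the first, each center with nonzero weight is within \<open>\<delta>\<close>
  of \<open>x\<close>; the second is a scalar multiple of \<open>x\<close>.\<close>

lemma norm_diff_partition_le:
  fixes d :: "nat \<Rightarrow> 'a::real_normed_vector"
  assumes "\<delta> \<ge> 0" "\<And>i. 0 \<le> \<psi> i" "\<And>i. \<psi> i \<noteq> 0 \<Longrightarrow> dist x (d i) \<le> \<delta>" "(\<Sum>i<I. \<psi> i) \<le> 1"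
  shows "norm (x - (\<Sum>i<I. \<psi> i *\<^sub>R d i)) \<le> \<delta> + (1 - (\<Sum>i<I. \<psi> i)) * norm x"
proof -
  have "x - (\<Sum>i<I. \<psi> i *\<^sub>R d i)
      = (\<Sum>i<I. \<psi> i *\<^sub>R (x - d i)) + (1 - (\<Sum>i<I. \<psi> i)) *\<^sub>R x"
    by (simp add: algebra_simps sum_subtractf scaleR_sum_left)
  also have "norm \<dots> \<le> norm (\<Sum>i<I. \<psi> i *\<^sub>R (x - d i)) + (1 - (\<Sum>i<I. \<psi> i)) * norm x"
    using assms(4) by (intro order_trans[OF norm_triangle_ineq]) simp
  also have "norm (\<Sum>i<I. \<psi> i *\<^sub>R (x - d i)) \<le> (\<Sum>i<I. \<psi> i * \<delta>)"
  proof (rule order_trans[OF norm_sum sum_mono])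
    fix i show "norm (\<psi> i *\<^sub>R (x - d i)) \<le> \<psi> i * \<delta>"
      using assms(2)[of i] assms(3)[of i]
      by (cases "\<psi> i = 0") (auto simp: dist_norm intro!: mult_left_mono)
  qed
  also have "(\<Sum>i<I. \<psi> i * \<delta>) \<le> \<delta>"
    using mult_right_mono[OF assms(4,1)] by (simp add: sum_distrib_right)
  finally show ?thesis by simp
qed

text \<open>The pointwise estimate integrated against \<open>r\<close>. Both error terms are scalar
  integrals, and the centers do not depend on \<open>N\<close>, so different measures can be
  compared through the same finite combination of vectors.\<close>

lemma norm_integral_diff_partition_le:
  fixes r :: "'a::{banach, second_countable_topology} \<Rightarrow> real"
  assumes r: "\<And>x. 0 \<le> r x" "integrable N r" and norm_r: "integrable N (\<lambda>x. norm x * r x)"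
    and ident: "(\<lambda>x. x) \<in> borel_measurable N"
    and \<psi>: "\<And>i::nat. \<psi> i \<in> borel_measurable N" "\<And>i x. 0 \<le> \<psi> i x" "\<And>I x. (\<Sum>i<I. \<psi> i x) \<le> 1"
      "\<And>i x. \<psi> i x \<noteq> 0 \<Longrightarrow> dist x (d i) \<le> \<delta>"
    and \<delta>: "\<delta> \<ge> 0"
  shows "norm ((\<integral>x. r x *\<^sub>R x \<partial>N) - (\<Sum>i<I. (\<integral>x. \<psi> i x * r x \<partial>N) *\<^sub>R d i))
    \<le> \<delta> * (\<integral>x. r x \<partial>N) + (\<integral>x. (1 - (\<Sum>i<I. \<psi> i x)) * (norm x * r x) \<partial>N)"
proof -
  have [measurable]: "\<And>i. \<psi> i \<in> borel_measurable N" "(\<lambda>x. x) \<in> borel_measurable N"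
    "r \<in> borel_measurable N" using \<psi>(1) ident r(2) by auto
  have \<psi>_le: "\<psi> i x \<le> 1" for i x
    using \<psi>(3)[of x "Suc i"] sum_nonneg[of "{..<i}" "\<lambda>i. \<psi> i x"] \<psi>(2) by simp
  have int_x: "integrable N (\<lambda>x. r x *\<^sub>R x)"
    by (rule Bochner_Integration.integrable_bound[OF norm_r]) (use r(1) in \<open>auto simp: mult.commute\<close>)
  have int_\<psi>: "integrable N (\<lambda>x. \<psi> i x * r x)" for i
    by (rule Bochner_Integration.integrable_bound[OF r(2)])
      (use r(1) \<psi>(2) \<psi>_le in \<open>auto simp: abs_mult intro!: mult_left_le_one_le\<close>)
  have int_rest: "integrable N (\<lambda>x. (1 - (\<Sum>i<I. \<psi> i x)) * (norm x * r x))"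
    by (rule Bochner_Integration.integrable_bound[OF norm_r])
      (use r(1) \<psi>(2,3) in \<open>auto simp: abs_mult sum_nonneg intro!: mult_left_le_one_le\<close>)
  have "(\<integral>x. r x *\<^sub>R x \<partial>N) - (\<Sum>i<I. (\<integral>x. \<psi> i x * r x \<partial>N) *\<^sub>R d i)
      = (\<integral>x. r x *\<^sub>R x - (\<Sum>i<I. (\<psi> i x * r x) *\<^sub>R d i) \<partial>N)"
    by (simp add: int_x int_\<psi> integral_sum)
  also have "norm \<dots> \<le> (\<integral>x. \<delta> * r x + (1 - (\<Sum>i<I. \<psi> i x)) * (norm x * r x) \<partial>N)"
  proof (rule order_trans[OF integral_norm_bound integral_mono])
    fix x
    have "r x *\<^sub>R x - (\<Sum>i<I. (\<psi> i x * r x) *\<^sub>R d i) = r x *\<^sub>R (x - (\<Sum>i<I. \<psi> i x *\<^sub>R d i))"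
      by (simp add: scaleR_right_diff_distrib scaleR_sum_right mult.commute)
    then have "norm (r x *\<^sub>R x - (\<Sum>i<I. (\<psi> i x * r x) *\<^sub>R d i))
        = r x * norm (x - (\<Sum>i<I. \<psi> i x *\<^sub>R d i))"
      using r(1) by simp
    also have "\<dots> \<le> r x * (\<delta> + (1 - (\<Sum>i<I. \<psi> i x)) * norm x)"
      by (intro mult_left_mono norm_diff_partition_le) (use r(1) \<delta> \<psi> in auto)
    finally show "norm (r x *\<^sub>R x - (\<Sum>i<I. (\<psi> i x * r x) *\<^sub>R d i))
        \<le> \<delta> * r x + (1 - (\<Sum>i<I. \<psi> i x)) * (norm x * r x)"
      by (simp add: algebra_simps)
  qed (use int_x int_\<psi> int_rest r(2) in auto)
  also have "\<dots> = \<delta> * (\<integral>x. r x \<partial>N) + (\<integral>x. (1 - (\<Sum>i<I. \<psi> i x)) * (norm x * r x) \<partial>N)"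
    by (simp add: int_rest r(2))
  finally show ?thesis .
qed

text \<open>Both vector integrals are close to finite sums over the same centers \<open>d i\<close>.
  The coefficients of these sums and both error terms are scalar integrals, whose convergence is
  already available. The choices are made in the order \<open>\<delta>\<close>, \<open>I\<close>,
  \<open>n\<close>.\<close>

lemma weighted_mean_tendsto:
  fixes r :: "'a::{banach, second_countable_topology} \<Rightarrow> real"
  assumes "weak_limit M Ms"
    and tails: "tails_vanish Ms r" "tails_vanish Ms (\<lambda>x. norm x * r x)"
    and r: "\<And>x. 0 \<le> r x" "integrable M r" "\<And>n. r \<in> borel_measurable (Ms n)"
    and norm_r: "integrable M (\<lambda>x. norm x * r x)"
    and cont: "AE x in M. isCont r x"
  shows "(\<lambda>n. \<integral>x. r x *\<^sub>R x \<partial>Ms n) \<longlonglongrightarrow> (\<integral>x. r x *\<^sub>R x \<partial>M)"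
proof (rule tendstoI)
  interpret weak_limit M Ms by fact
  note [measurable] = r(3) borel_M borel_Ms
  have [measurable]: "r \<in> borel_measurable M" using r(2) by simp
  have int_n: "integrable (Ms n) r" "integrable (Ms n) (\<lambda>x. norm x * r x)" for n
    using tails r prob_Ms by (auto intro!: tails_vanish_integrable)
  fix e :: real assume e: "0 < e"
  define c where "c = (\<integral>x. r x \<partial>M)"
  \<comment> \<open>The error \<open>\<delta> * c\<close> is paid twice in the limit, once for
    \<open>Ms n\<close> and once for \<open>M\<close>; together this stays below
    \<open>e / 2\<close>. The summand 1 keeps the denominator positive when
    \<open>c = 0\<close>.\<close>
  define \<delta> where "\<delta> = e / (4 * (c + 1))"
  have c: "0 \<le> c" unfolding c_def using r(1) by (intro integral_nonneg_AE) auto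
  then have \<delta>: "\<delta> > 0" using e by (simp add: \<delta>_def)
  have \<delta>c: "2 * (\<delta> * c) < e / 2" using c e by (simp add: \<delta>_def field_simps)
  obtain d :: "nat \<Rightarrow> 'a" and \<psi> :: "nat \<Rightarrow> 'a \<Rightarrow> real"
    where \<psi>: "\<And>i. continuous_on UNIV (\<psi> i)" "\<And>i x. 0 \<le> \<psi> i x"
      "\<And>i x. \<psi> i x \<noteq> 0 \<Longrightarrow> dist x (d i) \<le> \<delta>" "\<And>I x. (\<Sum>i<I. \<psi> i x) \<le> 1" "\<And>x. (\<lambda>i. \<psi> i x) sums 1"
    by (rule countable_partition_of_unity[OF \<delta>, where 'a = 'a]) (rule that)
  note [measurable] = continuous_measurable[OF \<psi>(1)]
  have \<psi>_le: "\<psi> i x \<le> 1" for i x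
    using \<psi>(4)[of x "Suc i"] sum_nonneg[of "{..<i}" "\<lambda>i. \<psi> i x"] \<psi>(2) by simp
  have sum_\<psi>: "0 \<le> (\<Sum>i<I. \<psi> i x)" for I x using \<psi>(2) by (simp add: sum_nonneg)
  have isCont_\<psi>: "isCont (\<psi> i) x" for i x using \<psi>(1) by (simp add: continuous_on_eq_continuous_at)
  define rest where "rest N I = (\<integral>x. (1 - (\<Sum>i<I. \<psi> i x)) * (norm x * r x) \<partial>N)" for N I
  have rest_le: "(1 - (\<Sum>i<I. \<psi> i x)) * (norm x * r x) \<le> norm x * r x" for I x
    using \<psi>(4) sum_\<psi> r(1) by (intro mult_left_le_one_le) auto
  have rest_nonneg: "0 \<le> (1 - (\<Sum>i<I. \<psi> i x)) * (norm x * r x)" for I x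
    using \<psi>(4) r(1) by simp
  \<comment> \<open>The limit is zero; the form \<open>1 - 1\<close> matches what the limit rules
    produce from the series of the weights.\<close>
  have "(\<lambda>I. rest M I) \<longlonglongrightarrow> (\<integral>x. (1 - 1) * (norm x * r x) \<partial>M)"
    unfolding rest_def
  proof (rule integral_dominated_convergence[where w = "\<lambda>x. norm x * r x"])
    show "AE x in M. (\<lambda>I. (1 - (\<Sum>i<I. \<psi> i x)) * (norm x * r x)) \<longlonglongrightarrow> (1 - 1) * (norm x * r x)"
      using \<psi>(5) unfolding sums_def by (intro AE_I2 tendsto_intros)
    show "AE x in M. norm ((1 - (\<Sum>i<I. \<psi> i x)) * (norm x * r x)) \<le> norm x * r x" for I
      using rest_le rest_nonneg by auto
  qed (use norm_r in measurable)
  then have "(\<lambda>I. rest M I) \<longlonglongrightarrow> 0" by simp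
  \<comment> \<open>\<open>I\<close> is fitted to \<open>M\<close> only. Since
    \<open>rest (Ms n) I\<close> tends to \<open>rest M I\<close>, the same \<open>I\<close> serves
    all large \<open>n\<close>.\<close>
  from order_tendstoD(2)[OF this, of "e / 4"] e obtain I where I: "rest M I < e / 4"
    by (auto simp: eventually_sequentially)
  have lim_c: "(\<lambda>n. \<integral>x. r x \<partial>Ms n) \<longlonglongrightarrow> c"
    unfolding c_def by (rule integral_tendsto_tails_vanish[OF tails(1)]) (use r cont in auto)
  have lim_rest: "(\<lambda>n. rest (Ms n) I) \<longlonglongrightarrow> rest M I"
    unfolding rest_def
  proof (rule integral_tendsto_tails_vanish[OF tails(2) rest_nonneg rest_le])
    show "integrable M (\<lambda>x. (1 - (\<Sum>i<I. \<psi> i x)) * (norm x * r x))"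
      by (rule Bochner_Integration.integrable_bound[OF norm_r])
        (use rest_le rest_nonneg r(1) in auto)
    show "AE x in M. isCont (\<lambda>x. (1 - (\<Sum>i<I. \<psi> i x)) * (norm x * r x)) x"
      using cont by eventually_elim (intro continuous_intros isCont_\<psi>)
  qed measurable
  have lim_\<psi>: "(\<lambda>n. \<integral>x. \<psi> i x * r x \<partial>Ms n) \<longlonglongrightarrow> (\<integral>x. \<psi> i x * r x \<partial>M)" for i
  proof (rule integral_tendsto_tails_vanish[OF tails(1)])
    show *: "\<psi> i x * r x \<le> r x" "0 \<le> \<psi> i x * r x" for x
      using \<psi>(2) \<psi>_le r(1) by (auto intro: mult_left_le_one_le)
    show "integrable M (\<lambda>x. \<psi> i x * r x)"
      by (rule Bochner_Integration.integrable_bound[OF r(2)]) (use * r(1) in auto)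
    show "AE x in M. isCont (\<lambda>x. \<psi> i x * r x) x"
      using cont by eventually_elim (intro continuous_intros isCont_\<psi>)
  qed measurable
  define S where "S N = (\<Sum>i<I. (\<integral>x. \<psi> i x * r x \<partial>N) *\<^sub>R d i)" for N
  \<comment> \<open>This is the bound that the triangle inequality through \<open>S (Ms n)\<close>
    and \<open>S M\<close> yields; its limit is
    \<open>2 * \<delta> * c + 2 * rest M I\<close>.\<close>
  have "(\<lambda>n. \<delta> * (\<integral>x. r x \<partial>Ms n) + rest (Ms n) I + norm (S (Ms n) - S M) + (\<delta> * c + rest M I))
      \<longlonglongrightarrow> \<delta> * c + rest M I + norm (S M - S M) + (\<delta> * c + rest M I)"
    unfolding S_def by (intro tendsto_intros lim_c lim_rest lim_\<psi>)
  moreover have "\<delta> * c + rest M I + norm (S M - S M) + (\<delta> * c + rest M I) < e"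
    using \<delta>c I by simp
  ultimately have "\<forall>\<^sub>F n in sequentially.
      \<delta> * (\<integral>x. r x \<partial>Ms n) + rest (Ms n) I + norm (S (Ms n) - S M) + (\<delta> * c + rest M I) < e"
    by (rule order_tendstoD(2))
  then show "\<forall>\<^sub>F n in sequentially. dist (\<integral>x. r x *\<^sub>R x \<partial>Ms n) (\<integral>x. r x *\<^sub>R x \<partial>M) < e"
  proof eventually_elim
    case (elim n)
    have "norm ((\<integral>x. r x *\<^sub>R x \<partial>Ms n) - S (Ms n)) \<le> \<delta> * (\<integral>x. r x \<partial>Ms n) + rest (Ms n) I"
      unfolding S_def rest_def
      by (rule norm_integral_diff_partition_le) (use r(1) int_n \<psi> \<delta> in auto)
    moreover have "norm ((\<integral>x. r x *\<^sub>R x \<partial>M) - S M) \<le> \<delta> * c + rest M I"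
      unfolding S_def rest_def c_def
      by (rule norm_integral_diff_partition_le) (use r norm_r \<psi> \<delta> in auto)
    moreover have "norm (a - b) \<le> norm (a - s) + norm (s - t) + norm (b - t)" for a b s t :: 'a
      using norm_triangle_ineq[of "a - s" "s - b"] norm_triangle_ineq[of "s - t" "t - b"]
      by (simp add: norm_minus_commute)
    ultimately show ?case
      using elim unfolding dist_norm by (smt (verit))
  qed
qed

section \<open>The posterior as a normalized density\<close>

text \<open>\<open>measure_of\<close> takes the prescribed values only if they form a measure.
  Agreement with a density of \<open>m\<close> on Borel sets ensures this; \<open>distr\<close>
  along the identity restricts that density from the possibly larger sigma-algebra of
  \<open>m\<close> to the Borel sets.\<close>

lemma posterior_eq_distr_density:
  assumes ident: "(\<lambda>x. x) \<in> borel_measurable m"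
    and \<rho>: "\<And>x. 0 \<le> \<rho> x y" "integrable m (\<lambda>x. \<rho> x y)" "0 < (\<integral>x. \<rho> x y \<partial>m)"
  shows "posterior m \<rho> y =
    distr (density m (\<lambda>x. ennreal (\<rho> x y / (\<integral>x. \<rho> x y \<partial>m)))) borel (\<lambda>x. x)" (is "_ = ?D")
proof -
  let ?c = "\<integral>x. \<rho> x y \<partial>m"
  have [measurable]: "(\<lambda>x. \<rho> x y) \<in> borel_measurable m" using \<rho>(2) by simp
  have eq: "ennreal (posterior_prob m \<rho> U y) = emeasure ?D U" if "U \<in> sets borel" for U
  proof -
    note ident[measurable] that[measurable]
    have U: "U \<inter> space m \<in> sets m"
      using measurable_sets[OF ident that] by (simp add: vimage_def Int_def)
    have int: "integrable m (\<lambda>x. indicator U x * \<rho> x y / ?c)"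
      by (intro integrable_divide Bochner_Integration.integrable_bound[OF \<rho>(2)])
        (auto simp: \<rho>(1) split: split_indicator)
    have "emeasure ?D U = (\<integral>\<^sup>+x. ennreal (\<rho> x y / ?c) * indicator (U \<inter> space m) x \<partial>m)"
      using U by (simp add: emeasure_distr emeasure_density)
    also have "\<dots> = (\<integral>\<^sup>+x. ennreal (indicator U x * \<rho> x y / ?c) \<partial>m)"
      by (intro nn_integral_cong) (auto split: split_indicator)
    also have "\<dots> = ennreal (\<integral>x. indicator U x * \<rho> x y / ?c \<partial>m)"
      using \<rho> by (intro nn_integral_eq_integral int) auto
    finally show ?thesis by (simp add: posterior_prob_def)
  qed
  have "posterior m \<rho> y = measure_of (space ?D) (sets ?D) (emeasure ?D)"
    unfolding posterior_def
    by (simp, rule measure_of_eq) (use eq in \<open>auto simp: sets.sigma_sets_eq[of borel, simplified]\<close>)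
  then show ?thesis by (simp only: measure_of_of_measure)
qed

text \<open>Change of variables through \<open>distr\<close> and \<open>density\<close>. The
  equation also holds with the default value 0 of a non-integrable function, so integrability is
  stated separately to ensure genuine Bochner integrals.\<close>

lemma
  fixes m :: "'a::{banach, second_countable_topology} measure"
  assumes ident: "(\<lambda>x. x) \<in> borel_measurable m"
    and \<rho>: "\<And>x. 0 \<le> \<rho> x y" "integrable m (\<lambda>x. \<rho> x y)" "0 < (\<integral>x. \<rho> x y \<partial>m)"
  shows posterior_mean:
      "(\<integral>x. x \<partial>posterior m \<rho> y) = (\<integral>x. \<rho> x y *\<^sub>R x \<partial>m) /\<^sub>R (\<integral>x. \<rho> x y \<partial>m)"
    and integrable_posterior:
      "integrable m (\<lambda>x. norm x * \<rho> x y) \<Longrightarrow> integrable (posterior m \<rho> y) (\<lambda>x. x)"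
proof -
  let ?c = "\<integral>x. \<rho> x y \<partial>m"
  note ident[measurable]
  have [measurable]: "(\<lambda>x. \<rho> x y) \<in> borel_measurable m" using \<rho>(2) by simp
  have scale: "(\<rho> x y / ?c) *\<^sub>R x = inverse ?c *\<^sub>R (\<rho> x y *\<^sub>R x)" for x
    by (simp add: divide_inverse mult.commute)
  note post = posterior_eq_distr_density[of m \<rho> y, OF assms]
  have "(\<integral>x. x \<partial>posterior m \<rho> y) = (\<integral>x. (\<rho> x y / ?c) *\<^sub>R x \<partial>m)"
    unfolding post using \<rho> by (simp add: integral_distr integral_density)
  then show "(\<integral>x. x \<partial>posterior m \<rho> y) = (\<integral>x. \<rho> x y *\<^sub>R x \<partial>m) /\<^sub>R ?c"
    by (simp add: scale del: scaleR_scaleR)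
  assume "integrable m (\<lambda>x. norm x * \<rho> x y)"
  then have "integrable m (\<lambda>x. \<rho> x y *\<^sub>R x)"
    by (rule Bochner_Integration.integrable_bound) (use \<rho>(1) in \<open>auto simp: mult.commute\<close>)
  then have "integrable m (\<lambda>x. (\<rho> x y / ?c) *\<^sub>R x)"
    by (simp add: scale del: scaleR_scaleR)
  then show "integrable (posterior m \<rho> y) (\<lambda>x. x)"
    unfolding post using \<rho> by (simp add: integrable_distr_eq integrable_density)
qed

section \<open>Convergence of the conditional means\<close>

theorem theorem4p6:
  fixes P :: "'w measure"
    and X :: "'w \<Rightarrow> 'f::{banach, second_countable_topology}"
    and Xs :: "nat \<Rightarrow> 'w \<Rightarrow> 'f"
    and \<epsilon> :: "'w \<Rightarrow> 'g::{real_vector, topological_ab_group_add, t2_space}"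
    and L :: "'f \<Rightarrow> 'g"
    and Y :: "'w \<Rightarrow> 'g"
    and Ys :: "nat \<Rightarrow> 'w \<Rightarrow> 'g"
    and \<nu> :: "'g measure"
    and \<rho> :: "'f \<Rightarrow> 'g \<Rightarrow> real"
    and y :: 'g
    and N :: "'f set"
  assumes model: "observation_model P X Xs \<epsilon> L Y Ys \<nu> \<rho>"
    and y: "y \<in> M0 P X Xs \<rho>"
    and discont: "N \<in> null_sets (law P X)" "{x. \<not> isCont (\<lambda>x. \<rho> x y) x} \<subseteq> N"
    and L1: "integrable (law P X) (\<lambda>x. norm x * \<rho> x y)"
    and unif_integrable: "\<And>k::nat. k \<in> {0, 1} \<Longrightarrow>
      ((\<lambda>C::real. SUP n. \<integral>\<^sup>+x. ennreal (norm x ^ k * \<rho> x y) *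
          indicator {x. norm x ^ k * \<rho> x y > C} x \<partial>law P (Xs n)) \<longlongrightarrow> 0) at_top"
    and weak: "converges_weakly (\<lambda>n. law P (Xs n)) (law P X)"
  shows "(\<forall>n. integrable (posterior (law P (Xs n)) \<rho> y) (\<lambda>x. x)) \<and>
         integrable (posterior (law P X) \<rho> y) (\<lambda>x. x) \<and>
         (\<lambda>n. \<integral>x. x \<partial>posterior (law P (Xs n)) \<rho> y) \<longlonglongrightarrow> (\<integral>x. x \<partial>posterior (law P X) \<rho> y)"
proof -
  interpret observation_model P X Xs \<epsilon> L Y Ys \<nu> \<rho> by (rule model)
  have \<rho>_nonneg: "0 \<le> \<rho> x y" for x
    using rho_density[of x] by (simp add: is_density_def)
  \<comment> \<open>Completion preserves the total mass and only enlarges the sigma-algebra, so the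
    completed laws fit \<open>weak_limit\<close>.\<close>
  have Z: "prob_space (law P Z)" "(\<lambda>x. x) \<in> borel_measurable (law P Z)"
    if "random_variable borel Z" for Z :: "'w \<Rightarrow> 'f"
  proof -
    interpret D: prob_space "distr P borel Z" using that by (rule prob_space_distr)
    show "prob_space (law P Z)"
      unfolding law_def by (rule prob_spaceI) (simp add: D.emeasure_space_1[simplified])
    show "(\<lambda>x. x) \<in> borel_measurable (law P Z)"
      unfolding law_def by (rule measurable_completion) simp
  qed
  have W: "weak_limit (law P X) (\<lambda>n. law P (Xs n))"
    by (intro weak_limit.intro weak_limit_axioms.intro Z X_measurable Xs_measurable weak)
  \<comment> \<open>Membership of \<open>y\<close> in \<open>M0\<close> makes every normalizing
    constant finite and positive.\<close>
  have \<rho>_Z: "integrable (law P Z) (\<lambda>x. \<rho> x y)" "0 < (\<integral>x. \<rho> x y \<partial>law P Z)"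
    if "Z \<in> insert X (range Xs)" for Z
  proof -
    have *: "(\<lambda>x. \<rho> x y) \<in> borel_measurable (law P Z)"
        "0 < (\<integral>\<^sup>+x. ennreal (\<rho> x y) \<partial>law P Z)" "(\<integral>\<^sup>+x. ennreal (\<rho> x y) \<partial>law P Z) < \<infinity>"
      using y that unfolding M0_def by blast+
    then show int: "integrable (law P Z) (\<lambda>x. \<rho> x y)"
      using \<rho>_nonneg by (intro integrableI_nonneg) auto
    then show "0 < (\<integral>x. \<rho> x y \<partial>law P Z)"
      using *(2) \<rho>_nonneg by (simp add: nn_integral_eq_integral)
  qed
  have meas: "(\<lambda>x. \<rho> x y) \<in> borel_measurable (law P (Xs n))" for n
    using \<rho>_Z(1)[of "Xs n"] by simp
  have tails: "tails_vanish (\<lambda>n. law P (Xs n)) (\<lambda>x. \<rho> x y)"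
      "tails_vanish (\<lambda>n. law P (Xs n)) (\<lambda>x. norm x * \<rho> x y)"
    using unif_integrable[of 0] unif_integrable[of 1] by (simp_all add: tails_vanish_def)
  have cont: "AE x in law P X. isCont (\<lambda>x. \<rho> x y) x"
    by (rule AE_I'[OF discont(1)]) (use discont(2) in auto)
  \<comment> \<open>\<open>L1\<close> concerns the law of \<open>X\<close>; for the laws of
    \<open>Xs n\<close> integrability comes from the tail condition with
    \<open>k = 1\<close>.\<close>
  have norm_n: "integrable (law P (Xs n)) (\<lambda>x. norm x * \<rho> x y)" for n
    using Z[OF Xs_measurable[of n]] meas[of n] \<rho>_nonneg
    by (intro tails_vanish_integrable[OF tails(2)]) auto
  interpret weak_limit "law P X" "\<lambda>n. law P (Xs n)" by (rule W)
  have "(\<lambda>n. \<integral>x. \<rho> x y \<partial>law P (Xs n)) \<longlonglongrightarrow> (\<integral>x. \<rho> x y \<partial>law P X)"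
    by (rule integral_tendsto_tails_vanish[OF tails(1)]) (use \<rho>_nonneg meas cont \<rho>_Z in auto)
  moreover have "(\<lambda>n. \<integral>x. \<rho> x y *\<^sub>R x \<partial>law P (Xs n)) \<longlonglongrightarrow> (\<integral>x. \<rho> x y *\<^sub>R x \<partial>law P X)"
    by (rule weighted_mean_tendsto[OF W tails \<rho>_nonneg _ meas L1 cont]) (use \<rho>_Z in auto)
  \<comment> \<open>Numerators and denominators converge separately, and the limit of the
    denominators is positive.\<close>
  ultimately have "(\<lambda>n. (\<integral>x. \<rho> x y *\<^sub>R x \<partial>law P (Xs n)) /\<^sub>R (\<integral>x. \<rho> x y \<partial>law P (Xs n)))
      \<longlonglongrightarrow> (\<integral>x. \<rho> x y *\<^sub>R x \<partial>law P X) /\<^sub>R (\<integral>x. \<rho> x y \<partial>law P X)"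
    using \<rho>_Z(2)[of X] by (intro tendsto_intros) auto
  then show ?thesis
    using L1 norm_n by (simp add: posterior_mean integrable_posterior borel_M borel_Ms \<rho>_nonneg \<rho>_Z)
qed

end
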